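(* The triplet $(\overline{\mathbb{IR}},+,\cdot)$, where $\overline{\mathbb{IR}}$ is the group of differences of the semigroup of intervals $(\mathbb{IR},+)$ and $\cdot$ is the external multiplication $\mathbb{R}\times\overline{\mathbb{IR}}\to\overline{\mathbb{IR}}$ described in the context, is a real vector space.
   Context: $\mathbb{IR}$ denotes the set of closed bounded intervals $x=[x^-,x^+]$ of $\mathbb{R}$ with $x^-\le x^+$; a real $\alpha$ is identified with $[\alpha,\alpha]$ and $0=[0,0]$. Addition is $[x^-,x^+]+[y^-,y^+]=[x^-+y^-,x^++y^+]$. On $\mathbb{IR}\times\mathbb{IR}$ put $(x,y)\sim(z,t)$ iff $x+t=y+z$; the quotient is $\overline{\mathbb{IR}}$, with classes written $\overline{(x,y)}$. It is an abelian group for $\overline{(x,y)}+\overline{(z,t)}=\overline{(x+z,y+t)}$; the inverse of $\overline{(x,y)}$ is $\smallsetminus\overline{(x,y)}=\overline{(y,x)}$. Every element of $\overline{\mathbb{IR}}$ can be written as $\overline{(A,0)}$ or $\overline{(0,A)}$ with $A\in\mathbb{IR}$ (and both only when $A$ is degenerate: $\overline{(\alpha,0)}=\overline{(0,-\alpha)}$ for $\alpha\in\mathbb{R}$). External multiplication: for real $\alpha\ge 0$ and $A=[a,b]\in\mathbb{IR}$ let $\alpha A=[\alpha a,\alpha b]$. For $\alpha\ge0$: $\alpha\cdot\overline{(A,0)}=\overline{(\alpha A,0)}$ and $\alpha\cdot\overline{(0,A)}=\overline{(0,\alpha A)}$. For $\alpha<0$, with $\beta=-\alpha$: $\alpha\cdot\overline{(A,0)}=\overline{(0,\beta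 A)}$ and $\alpha\cdot\overline{(0,A)}=\overline{(\beta A,0)}$. *)

theory Defs
  imports Complex_Main "HOL-Library.Interval"
begin

text \<open>Meaningful for \<open>0 \<le> \<alpha>\<close> only (otherwise the pair need not be ordered); it is never applied to
  negative factors below.\<close>

definition scale_interval :: "real \<Rightarrow> real interval \<Rightarrow> real interval"
  where "scale_interval \<alpha> A = Interval (\<alpha> * lower A, \<alpha> * upper A)"

fun diff_rel :: "real interval \<times> real interval \<Rightarrow> real interval \<times> real interval \<Rightarrow> bool" where
  "diff_rel (x, y) (z, t) \<longleftrightarrow> x + t = y + z"

lemma equivp_diff_rel: "equivp diff_rel"
  by (intro equivpI reflpI sympI transpI) (auto simp: interval_eq_iff add.commute)

quotient_type gen_interval = "real interval \<times> real interval" / diff_rel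
  morphisms rep_gen_interval class_of
  by (rule equivp_diff_rel)

text \<open>The instantiated classes are purely syntactic: they carry no axioms, and no algebraic
  law of the operations is presupposed.\<close>

instantiation gen_interval :: "{zero, plus, uminus, minus}"
begin

lift_definition zero_gen_interval :: gen_interval is "(0, 0)" .

lift_definition plus_gen_interval :: "gen_interval \<Rightarrow> gen_interval \<Rightarrow> gen_interval"
  is "\<lambda>(x, y) (z, t). (x + z, y + t)"
  by (auto simp: interval_eq_iff)

lift_definition uminus_gen_interval :: "gen_interval \<Rightarrow> gen_interval"
  is "\<lambda>(x, y). (y, x)"
  by auto

definition minus_gen_interval :: "gen_interval \<Rightarrow> gen_interval \<Rightarrow> gen_interval"
  where "u - v = u + - (v :: gen_interval)"

instance ..

end

inductive scales_to :: "real \<Rightarrow> gen_interval \<Rightarrow> gen_interval \<Rightarrow> bool" where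
  nonneg_left: "0 \<le> \<alpha> \<Longrightarrow> scales_to \<alpha> (class_of (A, 0)) (class_of (scale_interval \<alpha> A, 0))"
| nonneg_right: "0 \<le> \<alpha> \<Longrightarrow> scales_to \<alpha> (class_of (0, A)) (class_of (0, scale_interval \<alpha> A))"
| neg_left: "\<alpha> < 0 \<Longrightarrow> scales_to \<alpha> (class_of (A, 0)) (class_of (0, scale_interval (- \<alpha>) A))"
| neg_right: "\<alpha> < 0 \<Longrightarrow> scales_to \<alpha> (class_of (0, A)) (class_of (scale_interval (- \<alpha>) A, 0))"

instantiation gen_interval :: scaleR
begin

text \<open>The four rules of \<^const>\<open>scales_to\<close> determine a function; the lemmas at the end of this
  theory show that the description below always denotes and satisfies them.\<close>

definition scaleR_gen_interval :: "real \<Rightarrow> gen_interval \<Rightarrow> gen_interval"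
  where "\<alpha> *\<^sub>R u = (THE v. scales_to \<alpha> u v)"

instance ..

end

lemma class_of_eq_iff: "class_of (x, y) = class_of (z, t) \<longleftrightarrow> x + t = y + z"
  by (simp add: gen_interval.abs_eq_iff)

lemma lower_scale_interval: "0 \<le> \<alpha> \<Longrightarrow> lower (scale_interval \<alpha> A) = \<alpha> * lower A"
  by (simp add: scale_interval_def lower.rep_eq[of "Interval _"] Interval_inverse mult_left_mono)

lemma upper_scale_interval: "0 \<le> \<alpha> \<Longrightarrow> upper (scale_interval \<alpha> A) = \<alpha> * upper A"
  by (simp add: scale_interval_def upper.rep_eq[of "Interval _"] Interval_inverse mult_left_mono)

lemma class_of_cases:
  obtains (left) A where "u = class_of (A, 0)" | (right) A where "u = class_of (0, A)"
proof -
  obtain x y where u: "u = class_of (x, y)"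
    by (induction u rule: gen_interval.abs_induct) auto
  define c d where "c = lower x - lower y" and "d = upper x - upper y"
  show thesis
  proof (cases "c \<le> d")
    case True
    then have "lower (Interval (c, d)) = c" "upper (Interval (c, d)) = d"
      by (simp_all add: lower.rep_eq upper.rep_eq Interval_inverse)
    then show thesis
      using left[of "Interval (c, d)"]
      by (simp add: u class_of_eq_iff interval_eq_iff c_def d_def)
  next
    case False
    then have "lower (Interval (-c, -d)) = -c" "upper (Interval (-c, -d)) = -d"
      by (simp_all add: lower.rep_eq upper.rep_eq Interval_inverse)
    then show thesis
      using right[of "Interval (-c, -d)"]
      by (simp add: u class_of_eq_iff interval_eq_iff c_def d_def)
  qed
qed

lemma scales_to_unique:
  assumes "scales_to \<alpha> u v" "scales_to \<alpha> u w"
  shows "v = w"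
proof -
  have zero: "\<alpha> * a + \<alpha> * b = 0" "- (\<alpha> * a) = \<alpha> * b" if "a + b = 0" for a b :: real
    using that by (auto simp: add_eq_0_iff)
  show ?thesis
    using assms
    by (auto elim!: scales_to.cases
        simp: class_of_eq_iff interval_eq_iff lower_scale_interval upper_scale_interval zero)
qed

lemma ex1_scales_to: "\<exists>!v. scales_to \<alpha> u v"
proof (rule ex_ex1I)
  show "\<exists>v. scales_to \<alpha> u v"
    by (cases u rule: class_of_cases; cases "0 \<le> \<alpha>")
      (auto simp: not_le intro: scales_to.intros)
qed (rule scales_to_unique)

lemma scaleR_eqI: "scales_to \<alpha> u v \<Longrightarrow> \<alpha> *\<^sub>R u = v"
  unfolding scaleR_gen_interval_def by (rule the1_equality[OF ex1_scales_to])

lemma scaleR_class_of: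
  "0 \<le> \<alpha> \<Longrightarrow> \<alpha> *\<^sub>R class_of (A, 0) = class_of (scale_interval \<alpha> A, 0)"
  "0 \<le> \<alpha> \<Longrightarrow> \<alpha> *\<^sub>R class_of (0, A) = class_of (0, scale_interval \<alpha> A)"
  "\<alpha> < 0 \<Longrightarrow> \<alpha> *\<^sub>R class_of (A, 0) = class_of (0, scale_interval (- \<alpha>) A)"
  "\<alpha> < 0 \<Longrightarrow> \<alpha> *\<^sub>R class_of (0, A) = class_of (scale_interval (- \<alpha>) A, 0)"
  by (auto intro: scaleR_eqI scales_to.intros)

end

theory Submission
  imports Defs
begin

text \<open>A generalized interval has two real coordinates, the differences of the lower and of the
  upper endpoints of a representing pair. They are independent of the pair because interval
  addition is endpointwise, and they determine the class by the very definition of the relation.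
  So \<open>u \<mapsto> (gen_lower u, gen_upper u)\<close> is an injection into \<open>\<real>\<^sup>2\<close>, and it is additive.

  The external multiplication is linear in these coordinates as well. For a nonnegative factor
  this is clear. For a negative factor \<open>\<alpha>\<close> the multiplication scales by \<open>- \<alpha>\<close> and exchanges the two
  components of the pair; the exchange negates the difference of endpoints, so that each
  coordinate is multiplied by \<open>- (- \<alpha>) = \<alpha>\<close>. (Had \<open>\<alpha>\<close> acted on \<open>(A, 0)\<close> by the usual product of
  an interval with a negative number, lower and upper endpoints would be exchanged instead, and
  distributivity over sums of factors would fail.) All vector space axioms are therefore inherited
  coordinatewise from \<open>\<real>\<^sup>2\<close>.\<close>

lift_definition gen_lower :: "gen_interval \<Rightarrow> real" is "\<lambda>(x, y). lower x - lower y"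
  by (auto simp: interval_eq_iff)

lift_definition gen_upper :: "gen_interval \<Rightarrow> real" is "\<lambda>(x, y). upper x - upper y"
  by (auto simp: interval_eq_iff)

lemma gen_lower_class_of: "gen_lower (class_of (x, y)) = lower x - lower y"
  by (simp add: gen_lower.abs_eq)

lemma gen_upper_class_of: "gen_upper (class_of (x, y)) = upper x - upper y"
  by (simp add: gen_upper.abs_eq)

lemma gen_interval_eq_iff: "u = v \<longleftrightarrow> gen_lower u = gen_lower v \<and> gen_upper u = gen_upper v"
  by transfer (auto simp: interval_eq_iff)

lemma gen_lower_zero: "gen_lower 0 = 0" and gen_upper_zero: "gen_upper 0 = 0"
  by (transfer; simp)+

lemma gen_lower_plus: "gen_lower (u + v) = gen_lower u + gen_lower v"
  by transfer auto

lemma gen_upper_plus: "gen_upper (u + v) = gen_upper u + gen_upper v"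
  by transfer auto

lemma gen_lower_uminus: "gen_lower (- u) = - gen_lower u"
  by transfer auto

lemma gen_upper_uminus: "gen_upper (- u) = - gen_upper u"
  by transfer auto

text \<open>Exchanging the components of a pair negates both coordinates, which supplies exactly the
  sign that scaling by \<open>- \<alpha>\<close> has dropped when \<open>\<alpha> < 0\<close>; hence no case distinction survives.\<close>

lemma gen_lower_scaleR: "gen_lower (\<alpha> *\<^sub>R u) = \<alpha> * gen_lower u"
  by (cases u rule: class_of_cases; cases "0 \<le> \<alpha>")
    (simp_all add: scaleR_class_of gen_lower_class_of lower_scale_interval)

lemma gen_upper_scaleR: "gen_upper (\<alpha> *\<^sub>R u) = \<alpha> * gen_upper u"
  by (cases u rule: class_of_cases; cases "0 \<le> \<alpha>")
    (simp_all add: scaleR_class_of gen_upper_class_of upper_scale_interval)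

lemmas gen_interval_coordinates =
  gen_interval_eq_iff minus_gen_interval_def
  gen_lower_zero gen_upper_zero gen_lower_plus gen_upper_plus
  gen_lower_uminus gen_upper_uminus gen_lower_scaleR gen_upper_scaleR

theorem theorem9:
  shows "class.real_vector (+) 0 (-) uminus
    ((*\<^sub>R) :: real \<Rightarrow> gen_interval \<Rightarrow> gen_interval)"
  by unfold_locales (simp_all add: gen_interval_coordinates algebra_simps)

end
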